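(* Let $p$ be a prime. For a triple $(a,b,c)\in\mathbb{Z}^3$ and $u\in\{0,1,\dots,p-1\}$, let $d_p(u)$ denote the density of nodes of the network generated by $(a,b,c)$ whose weight is congruent to $u$ modulo $p$, i.e. $d_p(u)=\lim_{N\to\infty}\#\{(m,n)\in\{-N,\dots,N\}^2: W(m,n)\equiv u \pmod p\}/(2N+1)^2$, where $W$ is the weight function of that network. Then: (1) If the germ is $(a,b,c)=(0,0,0)$: - if $p=2$, then $d_2(0)=3/4$ and $d_2(1)=1/4$; - if $p=3$, then $d_3(0)=d_3(1)=d_3(2)=3/9$; - if $p\ge5$ and $p\equiv1\pmod 6$, then $d_p\big((p-1)/3\big)=(2p-1)/p^2$ and $d_p(u)=(p-1)/p^2$ for all $u\in\{0,\dots,p-1\}$ with $u\neq(p-1)/3$; - if $p\ge5$ and $p\equiv5\pmod 6$, then $d_p\big((2p-1)/3\big)=1/p^2$ and $d_p(u)=(p+1)/p^2$ for all $u\in\{0,\dots,p-1\}$ with $u\neq(2p-1)/3$. (2) If the germ is $(a,b,c)=(0,1,1)$: - if $p=2$, then $d_2(0)=1/4$ and $d_2(1)=3/4$; - if $p=3$, then $d_3(0)=3/9$, $d_3(1)=6/9$, $d_3(2)=0$; - if $p\ge5$ and $p\equiv1\pmod 6$, then $d_p(0)=(2p-1)/p^2$ and $d_p(u)=(p-1)/p^2$ for $u=1,\dots,p-1$; - if $p\ge5$ and $p\equiv5\pmod 6$, then $d_p(0)=1/p^2$ and $d_p(u)=(p+1)/p^2$ for $u=1,\dots,p-1$.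
   Context: Let $\rho=e^{i\pi/3}$ and identify the node $m+n\rho$ of the triangular lattice with $(m,n)\in\mathbb{Z}^2$. Given integers $a,b,c$, the network generated by the base triangle (germ) $(a,b,c)$ is the function $W:\mathbb{Z}^2\to\mathbb{Z}$ (the weights of the nodes) with $W(0,0)=a$, $W(1,0)=b$, $W(0,1)=c$, satisfying the lozenge rule: in every lozenge formed by two adjacent unit triangles of the lattice, the sum of the weights at the ends of the long diagonal is $1$ more than the sum of the weights at the ends of the short diagonal. Explicitly, for all $(m,n)\in\mathbb{Z}^2$: $W(m,n)+W(m+1,n+1)=W(m+1,n)+W(m,n+1)+1$, $W(m+1,n)+W(m-1,n+1)=W(m,n)+W(m,n+1)+1$, $W(m,n+1)+W(m+1,n-1)=W(m,n)+W(m+1,n)+1$. Such a function exists and is unique. (Equivalently, the weights of the unit triangles are exactly the triples obtained from $(a,b,c)$ by iterating the maps $H'(x,y,z)=(-x+1+y+z,y,z)$, $H''(x,y,z)=(x,-y+1+z+x,z)$, $H'''(x,y,z)=(x,y,-z+1+x+y)$.) *)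

theory Defs
  imports Complex_Main "HOL-Number_Theory.Cong" "HOL-Computational_Algebra.Primes"
begin

definition lozenge_rule :: "(int \<Rightarrow> int \<Rightarrow> int) \<Rightarrow> bool" where
  "lozenge_rule W \<longleftrightarrow>
     (\<forall>m n. W m n + W (m + 1) (n + 1) = W (m + 1) n + W m (n + 1) + 1 \<and>
            W (m + 1) n + W (m - 1) (n + 1) = W m n + W m (n + 1) + 1 \<and>
            W m (n + 1) + W (m + 1) (n - 1) = W m n + W (m + 1) n + 1)"

definition is_network :: "int \<Rightarrow> int \<Rightarrow> int \<Rightarrow> (int \<Rightarrow> int \<Rightarrow> int) \<Rightarrow> bool" where
  "is_network a b c W \<longleftrightarrow> W 0 0 = a \<and> W 1 0 = b \<and> W 0 1 = c \<and> lozenge_rule W"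

text \<open>The description below is proper: see \<open>is_network_ex1\<close>.\<close>

definition network :: "int \<Rightarrow> int \<Rightarrow> int \<Rightarrow> (int \<Rightarrow> int \<Rightarrow> int)" where
  "network a b c = (THE W. is_network a b c W)"

text \<open>Existence of the limit is part of the assertion that the density is \<open>d\<close>.\<close>

definition has_residue_density :: "(int \<Rightarrow> int \<Rightarrow> int) \<Rightarrow> nat \<Rightarrow> nat \<Rightarrow> real \<Rightarrow> bool" where
  "has_residue_density W p u d \<longleftrightarrow>
     (\<lambda>N. real (card {(m, n). m \<in> {- int N..int N} \<and> n \<in> {- int N..int N} \<and>
                              [W m n = int u] (mod int p)})
            / (2 * real N + 1)\<^sup>2) \<longlonglongrightarrow> d"

lemma is_network_quadratic:
  "is_network a b c
     (\<lambda>m n. a + (b - a) * m + (c - a) * n + m * (m - 1) + n * (n - 1) + m * n)"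
  by (simp add: is_network_def lozenge_rule_def algebra_simps)

lemma is_network_unique:
  assumes V: "is_network a b c V" and W: "is_network a b c W"
  shows "V = W"
proof -
  define D where "D m n = V m n - W m n" for m n
  have r1: "D m n + D (m + 1) (n + 1) = D (m + 1) n + D m (n + 1)"
   and r2: "D (m + 1) n + D (m - 1) (n + 1) = D m n + D m (n + 1)"
   and r3: "D m (n + 1) + D (m + 1) (n - 1) = D m n + D (m + 1) n" for m n
    using V W unfolding is_network_def lozenge_rule_def D_def by (smt (verit))+
  define T where "T m n \<longleftrightarrow> D m n = 0 \<and> D (m + 1) n = 0 \<and> D m (n + 1) = 0" for m n
  have T0: "T 0 0"
    using V W by (simp add: T_def D_def is_network_def)
  have Tm: "T m 0" for m
  proof (induction m rule: int_induct[where k = 0])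
    case base
    show ?case by (rule T0)
  next
    case (step1 i)
    then show ?case using r1[of i 0] r2[of "i + 1" 0] by (simp add: T_def)
  next
    case (step2 i)
    then show ?case using r1[of "i - 1" 0] r2[of i 0] by (simp add: T_def)
  qed
  have Tmn: "T m n" for m n
  proof (induction n rule: int_induct[where k = 0])
    case base
    show ?case by (rule Tm)
  next
    case (step1 i)
    then show ?case using r1[of m i] r3[of m "i + 1"] by (simp add: T_def)
  next
    case (step2 i)
    then show ?case using r1[of m "i - 1"] r3[of m i] by (simp add: T_def)
  qed
  show ?thesis
    using Tmn by (intro ext) (simp add: T_def D_def)
qed

lemma is_network_ex1: "\<exists>!W. is_network a b c W"
  using is_network_quadratic is_network_unique by blast

lemma is_network_network: "is_network a b c (network a b c)"
  unfolding network_def by (rule theI'[OF is_network_ex1])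

end

theory Submission
  imports Defs "HOL-Number_Theory.Pocklington"
begin

text \<open>
  The network of \<open>(0, 1, 1)\<close> is the Eisenstein norm form \<open>Q = x\<^sup>2 + x y + y\<^sup>2\<close>, and that of \<open>(0, 0, 0)\<close>
  is \<open>Q - x - y\<close>, which for \<open>p > 3\<close> equals \<open>Q - 1/3\<close> modulo \<open>p\<close> after translation by \<open>(1/3, 1/3)\<close>. By
  periodicity the densities are the sizes of the level sets of these functions modulo \<open>p\<close>, divided
  by \<open>p\<^sup>2\<close>. Multiplication by an Eisenstein integer of norm \<open>c\<close> maps level \<open>k\<close> of \<open>Q\<close> injectively to level
  \<open>k c\<close>, and \<open>Q\<close> represents every residue, so all nonzero levels have the same size. The zero level
  consists of two lines if \<open>p \<equiv> 1 (mod 3)\<close> and of the origin if \<open>p \<equiv> 2 (mod 3)\<close>; the common size of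
  the other levels follows by counting all \<open>p\<^sup>2\<close> pairs.
\<close>

section \<open>Level sets modulo \<open>p\<close> and the comparison of their sizes\<close>

definition residue_solutions :: "int \<Rightarrow> (int \<Rightarrow> int \<Rightarrow> int) \<Rightarrow> int \<Rightarrow> (int \<times> int) set" where
  "residue_solutions p f u =
     {(x, y). x \<in> {0..<p} \<and> y \<in> {0..<p} \<and> [f x y = u] (mod p)}"

text \<open>The condition that \<open>f\<close> descends to a function on the torus (Z/p)^2, for
  which the square of least residues in \<open>residue_solutions\<close> is a set of
  representatives.\<close>

definition residue_periodic :: "int \<Rightarrow> (int \<Rightarrow> int \<Rightarrow> int) \<Rightarrow> bool" where
  "residue_periodic p f \<longleftrightarrow>
     (\<forall>x y x' y'. [x = x'] (mod p) \<longrightarrow> [y = y'] (mod p) \<longrightarrow> [f x y = f x' y'] (mod p))"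

lemma residue_periodicD:
  "residue_periodic p f \<Longrightarrow> [x = x'] (mod p) \<Longrightarrow> [y = y'] (mod p) \<Longrightarrow>
     [f x y = f x' y'] (mod p)"
  unfolding residue_periodic_def by blast

lemma finite_residue_solutions [simp]: "finite (residue_solutions p f u)"
  by (rule finite_subset[of _ "{0..<p} \<times> {0..<p}"]) (auto simp: residue_solutions_def)

text \<open>A double sum over explicit ranges can be evaluated by the simplifier; this settles
  \<open>p = 2\<close> and \<open>p = 3\<close>.\<close>

lemma card_residue_solutions_eq_sum:
  "card (residue_solutions p f u) =
     (\<Sum>x\<in>{0..<p}. \<Sum>y\<in>{0..<p}. if [f x y = u] (mod p) then 1 else 0)"
proof -
  have "residue_solutions p f u = Sigma {0..<p} (\<lambda>x. {y \<in> {0..<p}. [f x y = u] (mod p)})"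
    by (auto simp: residue_solutions_def)
  moreover have "finite {y \<in> {0..<p}. [f x y = u] (mod p)}" for x
    by (rule finite_subset[of _ "{0..<p}"]) auto
  ultimately have "card (residue_solutions p f u) = (\<Sum>x\<in>{0..<p}. card {y \<in> {0..<p}. [f x y = u] (mod p)})"
    by simp
  then show ?thesis
    by (simp add: sum.If_cases Int_def)
qed

lemma sum_card_residue_solutions:
  assumes "p > 0"
  shows "(\<Sum>u\<in>{0..<p}. card (residue_solutions p f u)) = nat p * nat p"
proof -
  have "(\<Union>u\<in>{0..<p}. residue_solutions p f u) = {0..<p} \<times> {0..<p}"
    using assms by (auto simp: residue_solutions_def cong_def intro!: bexI[of _ "f _ _ mod p"])
  moreover have "card (\<Union>u\<in>{0..<p}. residue_solutions p f u) =
      (\<Sum>u\<in>{0..<p}. card (residue_solutions p f u))"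
    by (rule card_UN_disjoint) (simp_all, auto simp: residue_solutions_def cong_def)
  ultimately show ?thesis
    by (simp add: card_cartesian_product)
qed

text \<open>The common tool for comparing levels: a substitution \<open>(F, G)\<close> that is
  injective modulo \<open>p\<close> and carries one level into another. Its values are reduced
  modulo \<open>p\<close> to return to the square of representatives, which is why \<open>g\<close>
  must be periodic. Equalities come from using it in both directions.\<close>

lemma card_residue_solutions_le:
  assumes "p > 0" and g: "residue_periodic p g"
    and lev: "\<And>x y. [f x y = u] (mod p) \<Longrightarrow> [g (F x y) (G x y) = v] (mod p)"
    and inj: "\<And>x y x' y'. [F x y = F x' y'] (mod p) \<Longrightarrow> [G x y = G x' y'] (mod p) \<Longrightarrow>
                [x = x'] (mod p) \<and> [y = y'] (mod p)"
  shows "card (residue_solutions p f u) \<le> card (residue_solutions p g v)"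
proof (rule card_inj_on_le)
  let ?h = "\<lambda>(x, y). (F x y mod p, G x y mod p)"
  show "inj_on ?h (residue_solutions p f u)"
  proof (rule inj_onI, clarify)
    fix x y x' y'
    assume S: "(x, y) \<in> residue_solutions p f u" "(x', y') \<in> residue_solutions p f u"
      and "F x y mod p = F x' y' mod p" "G x y mod p = G x' y' mod p"
    then have "[x = x'] (mod p) \<and> [y = y'] (mod p)"
      by (intro inj) (simp_all add: cong_def)
    with S show "x = x' \<and> y = y'"
      by (auto simp: residue_solutions_def cong_def)
  qed
  show "?h ` residue_solutions p f u \<subseteq> residue_solutions p g v"
  proof clarify
    fix x y assume "(x, y) \<in> residue_solutions p f u"
    then have "[g (F x y) (G x y) = v] (mod p)"
      by (intro lev) (simp add: residue_solutions_def)
    moreover have "[g (F x y mod p) (G x y mod p) = g (F x y) (G x y)] (mod p)"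
      by (rule residue_periodicD[OF g]) (simp_all add: cong_def)
    ultimately show "(F x y mod p, G x y mod p) \<in> residue_solutions p g v"
      using \<open>p > 0\<close> by (auto simp: residue_solutions_def intro: cong_trans)
  qed
qed simp

section \<open>Densities of functions periodic modulo \<open>p\<close>\<close>

lemma card_residue_class_interval:
  fixes p r :: int
  assumes "0 \<le> r" "r < p"
  shows "\<bar>real (card {m \<in> {- int N..int N}. m mod p = r}) - (2 * real N + 1) / real_of_int p\<bar> \<le> 3"
proof -
  have p: "p > 0" using assms by simp
  have le_div: "k \<le> x div p \<longleftrightarrow> k * p \<le> x" for k x
  proof
    assume "k \<le> x div p"
    then have "k * p \<le> x div p * p" using p by (simp add: mult_right_mono)
    also have "\<dots> \<le> x" using p by (metis div_mult_mod_eq le_add_same_cancel1 pos_mod_sign)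
    finally show "k * p \<le> x" .
  next
    assume "k * p \<le> x"
    then show "k \<le> x div p" using zdiv_mono1[of "k * p" x p] p by simp
  qed
  have le: "p * k + r \<le> int N \<longleftrightarrow> k \<le> (int N - r) div p"
    and ge: "- int N \<le> p * k + r \<longleftrightarrow> - ((int N + r) div p) \<le> k" for k
  proof -
    have "p * k + r \<le> int N \<longleftrightarrow> k * p \<le> int N - r" by (auto simp: algebra_simps)
    then show "p * k + r \<le> int N \<longleftrightarrow> k \<le> (int N - r) div p"
      by (simp add: le_div)
    have "- int N \<le> p * k + r \<longleftrightarrow> - k * p \<le> int N + r" by (auto simp: algebra_simps)
    also have "\<dots> \<longleftrightarrow> - k \<le> (int N + r) div p"
      by (simp only: le_div)
    finally show "- int N \<le> p * k + r \<longleftrightarrow> - ((int N + r) div p) \<le> k" by linarith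
  qed
  \<comment> \<open>The lower end for \<open>k\<close> is the ceiling of -(N + r)/p, written as a
    negated floor.\<close>
  have "{m \<in> {- int N..int N}. m mod p = r} =
      (\<lambda>k. p * k + r) ` {- ((int N + r) div p)..(int N - r) div p}" (is "?L = ?R")
  proof
    show "?R \<subseteq> ?L" using le ge assms by auto
    show "?L \<subseteq> ?R"
    proof
      fix m assume m: "m \<in> ?L"
      then have "m = p * (m div p) + r" by (metis (lifting) mem_Collect_eq mult_div_mod_eq)
      with m show "m \<in> ?R" using le ge
        by (metis (no_types, lifting) atLeastAtMost_iff imageI mem_Collect_eq)
    qed
  qed
  moreover have "inj_on (\<lambda>k. p * k + r) A" for A
    using p by (auto simp: inj_on_def)
  ultimately have card: "card {m \<in> {- int N..int N}. m mod p = r} =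
      nat ((int N - r) div p + (int N + r) div p + 1)"
    by (simp add: card_image)
  \<comment> \<open>Each floor errs by at most 1 and the unrounded quotients add up to 2N/p, so the
    error is bounded independently of \<open>N\<close>. The constant 3 is generous; the density only
    needs boundedness.\<close>
  have fl: "real_of_int x / real_of_int p - 1 \<le> real_of_int (x div p)"
    "real_of_int (x div p) \<le> real_of_int x / real_of_int p" for x
    using real_of_int_div3[of x p] real_of_int_div4[of x p] by linarith+
  \<comment> \<open>These bounds keep the argument of \<open>nat\<close> nonnegative, so nothing is
    truncated. The value -1 does occur, namely for \<open>N\<close> below \<open>r\<close>, where
    the class may have no member in the interval.\<close>
  have "(int N + r) div p \<ge> 0" "(int N - r) div p \<ge> -1"
  proof -
    show "(int N + r) div p \<ge> 0" using assms by (simp add: pos_imp_zdiv_nonneg_iff)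
    show "(int N - r) div p \<ge> -1" using assms by (simp only: le_div)
  qed
  then have "real (card {m \<in> {- int N..int N}. m mod p = r}) =
      real_of_int ((int N - r) div p) + real_of_int ((int N + r) div p) + 1"
    unfolding card by simp
  moreover have "real_of_int (int N - r) / real_of_int p + real_of_int (int N + r) / real_of_int p =
      2 * real N / real_of_int p"
    by (simp add: add_divide_distrib[symmetric])
  moreover have "(2 * real N + 1) / real_of_int p = 2 * real N / real_of_int p + 1 / real_of_int p"
    by (simp add: add_divide_distrib)
  moreover have "0 \<le> 1 / real_of_int p" "1 / real_of_int p \<le> 1"
    using p by auto
  ultimately show ?thesis
    using fl[of "int N - r"] fl[of "int N + r"] by linarith
qed

lemma residue_class_interval_density:
  fixes p r :: int
  assumes "0 \<le> r" "r < p"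
  shows "(\<lambda>N. real (card {m \<in> {- int N..int N}. m mod p = r}) / (2 * real N + 1))
           \<longlonglongrightarrow> 1 / real_of_int p"
proof -
  have "(\<lambda>N. real (card {m \<in> {- int N..int N}. m mod p = r}) / (2 * real N + 1) - 1 / real_of_int p)
      \<longlonglongrightarrow> 0"
  proof (rule tendsto_0_le[where K = 3])
    show "(\<lambda>N. 1 / (2 * real N + 1)) \<longlonglongrightarrow> 0"
      \<comment> \<open>The null sequence 1/(n + 1) along the subsequence n = 2N.\<close>
      using LIMSEQ_subseq_LIMSEQ[OF LIMSEQ_inverse_real_of_nat, of "\<lambda>N. 2 * N"]
      by (simp add: strict_mono_def o_def inverse_eq_divide add.commute)
    show "\<forall>\<^sub>F N in sequentially. norm (real (card {m \<in> {- int N..int N}. m mod p = r}) / (2 * real N + 1)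
        - 1 / real_of_int p) \<le> norm (1 / (2 * real N + 1)) * 3"
    proof (rule always_eventually, rule allI)
      fix N :: nat
      let ?c = "real (card {m \<in> {- int N..int N}. m mod p = r})"
      have "?c / (2 * real N + 1) - 1 / real_of_int p =
          (?c - (2 * real N + 1) / real_of_int p) / (2 * real N + 1)"
        by (simp add: diff_divide_distrib)
      then have "norm (?c / (2 * real N + 1) - 1 / real_of_int p) =
          \<bar>?c - (2 * real N + 1) / real_of_int p\<bar> / (2 * real N + 1)"
        by (simp add: abs_divide)
      also have "\<dots> \<le> 3 / (2 * real N + 1)"
        using card_residue_class_interval[OF assms, of N] by (intro divide_right_mono) auto
      finally show "norm (?c / (2 * real N + 1) - 1 / real_of_int p) \<le> norm (1 / (2 * real N + 1)) * 3"
        by simp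
    qed
  qed
  then show ?thesis by (simp add: LIM_zero_iff)
qed

text \<open>The box splits according to the residues \<open>(r, s)\<close> of the two coordinates.
  Each pair contributes a product of two one-dimensional counts, of density 1/p^2, and the finitely
  many pairs lying in the level are summed.\<close>

lemma has_residue_density_periodic:
  fixes p u :: nat
  assumes "p > 0" and W: "residue_periodic (int p) W"
  shows "has_residue_density W p u (real (card (residue_solutions (int p) W (int u))) / (real p)\<^sup>2)"
proof -
  define S where "S = residue_solutions (int p) W (int u)"
  define C where "C N r = {m \<in> {- int N..int N}. m mod int p = r}" for N r
  have fin: "finite (C N r)" for N r
    unfolding C_def by (rule finite_subset[of _ "{- int N..int N}"]) auto
  have count: "card {(m, n). m \<in> {- int N..int N} \<and> n \<in> {- int N..int N} \<and>
      [W m n = int u] (mod int p)} = (\<Sum>(r, s)\<in>S. card (C N r) * card (C N s))" for N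
  proof -
    have per: "[W m n = W (m mod int p) (n mod int p)] (mod int p)" for m n
      by (rule residue_periodicD[OF W]) (simp_all add: cong_def)
    have "{(m, n). m \<in> {- int N..int N} \<and> n \<in> {- int N..int N} \<and> [W m n = int u] (mod int p)} =
        (\<Union>q\<in>S. C N (fst q) \<times> C N (snd q))" (is "?L = ?R")
    proof (rule Set.set_eqI)
      fix z :: "int \<times> int"
      obtain m n where z: "z = (m, n)" by (cases z)
      have "[W m n = int u] (mod int p) \<longleftrightarrow> (m mod int p, n mod int p) \<in> S"
        using per[of m n] \<open>p > 0\<close>
        by (auto simp: S_def residue_solutions_def cong_def)
      then show "z \<in> ?L \<longleftrightarrow> z \<in> ?R"
        by (force simp: C_def z)
    qed
    moreover have "card (\<Union>q\<in>S. C N (fst q) \<times> C N (snd q)) =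
        (\<Sum>q\<in>S. card (C N (fst q) \<times> C N (snd q)))"
      by (rule card_UN_disjoint) (simp_all add: fin S_def, auto simp: C_def)
    ultimately show ?thesis
      by (simp add: card_cartesian_product case_prod_beta)
  qed
  have "(\<lambda>N. \<Sum>(r, s)\<in>S. (real (card (C N r)) / (2 * real N + 1)) * (real (card (C N s)) / (2 * real N + 1)))
      \<longlonglongrightarrow> (\<Sum>(r, s)\<in>S. (1 / real_of_int (int p)) * (1 / real_of_int (int p)))"
    unfolding case_prod_beta C_def
    by (intro tendsto_sum tendsto_mult residue_class_interval_density)
      (auto simp: S_def residue_solutions_def)
  moreover have "(\<Sum>(r, s)\<in>S. (real (card (C N r)) / (2 * real N + 1)) * (real (card (C N s)) / (2 * real N + 1)))
      = real (\<Sum>(r, s)\<in>S. card (C N r) * card (C N s)) / (2 * real N + 1)\<^sup>2" for N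
    by (simp add: sum_divide_distrib power2_eq_square case_prod_beta)
  ultimately show ?thesis
    unfolding has_residue_density_def count S_def[symmetric]
    by (simp add: power2_eq_square)
qed

section \<open>Tools from arithmetic modulo a prime\<close>

lemma residue_solutions_cong:
  "[u = v] (mod p) \<Longrightarrow> residue_solutions p f u = residue_solutions p f v"
  by (auto simp: residue_solutions_def cong_def)

text \<open>Cramer's rule: eliminating one unknown leaves the determinant times the difference of
  the other, and the determinant is a unit modulo \<open>p\<close>.\<close>

lemma linear_map_inj_mod_prime:
  fixes p :: int
  assumes "prime p" and det: "\<not> p dvd a * d - b * c"
    and 1: "[a * x + b * y = a * x' + b * y'] (mod p)"
    and 2: "[c * x + d * y = c * x' + d * y'] (mod p)"
  shows "[x = x'] (mod p) \<and> [y = y'] (mod p)"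
proof -
  from 1 have d1: "p dvd (a * x + b * y) - (a * x' + b * y')" by (simp add: cong_iff_dvd_diff)
  from 2 have d2: "p dvd (c * x + d * y) - (c * x' + d * y')" by (simp add: cong_iff_dvd_diff)
  have "p dvd d * ((a * x + b * y) - (a * x' + b * y')) - b * ((c * x + d * y) - (c * x' + d * y'))"
    by (rule dvd_diff[OF dvd_mult dvd_mult]) (fact d1 d2)+
  also have "\<dots> = (a * d - b * c) * (x - x')" by (simp add: algebra_simps)
  finally have x: "p dvd x - x'" using assms(1) det by (simp add: prime_dvd_mult_iff)
  have "p dvd a * ((c * x + d * y) - (c * x' + d * y')) - c * ((a * x + b * y) - (a * x' + b * y'))"
    by (rule dvd_diff[OF dvd_mult dvd_mult]) (fact d1 d2)+
  also have "\<dots> = (a * d - b * c) * (y - y')" by (simp add: algebra_simps)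
  finally have "p dvd y - y'" using assms(1) det by (simp add: prime_dvd_mult_iff)
  with x show ?thesis by (simp add: cong_iff_dvd_diff)
qed

lemma fermat_theorem_int:
  fixes a :: int
  assumes "prime p" "\<not> int p dvd a"
  shows "[a ^ (p - 1) = 1] (mod int p)"
proof -
  have p: "int p > 0" using assms(1) prime_gt_0_nat by simp
  define b where "b = nat (a mod int p)"
  have b: "int b = a mod int p" using p by (simp add: b_def)
  have "\<not> p dvd b" using assms(2) by (metis b dvd_mod_iff int_dvd_int_iff dvd_refl)
  then have "[b ^ (p - 1) = 1] (mod p)" by (rule fermat_theorem[OF assms(1)])
  then have "[int b ^ (p - 1) = 1] (mod int p)"
    by (metis cong_int_iff of_nat_1 of_nat_power)
  then show ?thesis by (simp add: b cong_def power_mod)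
qed

lemma mod_prime_inverse_exists:
  fixes p a :: int
  assumes "prime p" "\<not> p dvd a"
  obtains b where "[a * b = 1] (mod p)"
  using assms by (metis cong_solve_coprime_int coprime_commute prime_imp_coprime)

text \<open>The \<open>(p + 1) div 2\<close> squares and the equally many values \<open>c - d * t\<^sup>2\<close> cannot be disjoint.\<close>
lemma sum_of_squares_represents_mod_prime:
  fixes p c d :: int
  assumes p: "prime p" "p > 2" and d: "\<not> p dvd d"
  shows "\<exists>s t. [s\<^sup>2 + d * t\<^sup>2 = c] (mod p)"
proof -
  have "odd p" using p by (simp add: prime_odd_int)
  then obtain h where h: "p = 2 * h + 1" by (elim oddE)
  then have h0: "h \<ge> 0" using p by simp
  define f where "f s = s\<^sup>2 mod p" for s
  define g where "g t = (c - d * t\<^sup>2) mod p" for t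
  \<comment> \<open>On \<open>{0..h}\<close> both the difference and the sum of two elements stay
    below \<open>p = 2 * h + 1\<close> in absolute value, so divisibility forces them to be 0; a
    zero sum means that both elements are 0.\<close>
  have sq: "s = t" if "p dvd s\<^sup>2 - t\<^sup>2" "s \<in> {0..h}" "t \<in> {0..h}" for s t
  proof -
    have "p dvd (s - t) * (s + t)" using that(1) by (simp add: power2_eq_square algebra_simps)
    then consider "p dvd s - t" | "p dvd s + t" using p(1) by (auto simp: prime_dvd_mult_iff)
    then show "s = t"
    proof cases
      case 1
      moreover have "\<bar>s - t\<bar> < p" using that h by auto
      ultimately show ?thesis using dvd_imp_le_int[of "s - t" p] p by fastforce
    next
      case 2
      moreover have "\<bar>s + t\<bar> < p" using that h by auto
      ultimately have "s + t = 0" using dvd_imp_le_int[of "s + t" p] p by fastforce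
      then show ?thesis using that by auto
    qed
  qed
  have "inj_on f {0..h}"
    by (rule inj_onI, rule sq) (auto simp: f_def mod_eq_dvd_iff)
  then have cf: "card (f ` {0..h}) = nat (h + 1)" by (simp add: card_image)
  have "inj_on g {0..h}"
  proof (rule inj_onI)
    fix s t assume st: "s \<in> {0..h}" "t \<in> {0..h}" "g s = g t"
    then have "p dvd (c - d * s\<^sup>2) - (c - d * t\<^sup>2)" by (simp add: g_def mod_eq_dvd_iff)
    also have "\<dots> = d * (t\<^sup>2 - s\<^sup>2)" by (simp add: algebra_simps)
    finally have "p dvd t\<^sup>2 - s\<^sup>2" using p d by (simp add: prime_dvd_mult_iff)
    then show "s = t" using sq[of t s] st by simp
  qed
  then have cg: "card (g ` {0..h}) = nat (h + 1)" by (simp add: card_image)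
  have "f ` {0..h} \<inter> g ` {0..h} \<noteq> {}"
  proof
    assume "f ` {0..h} \<inter> g ` {0..h} = {}"
    then have "card (f ` {0..h} \<union> g ` {0..h}) = nat (h + 1) + nat (h + 1)"
      by (simp add: card_Un_disjoint cf cg)
    moreover have "card (f ` {0..h} \<union> g ` {0..h}) \<le> card {0..<p}"
      using p by (intro card_mono) (auto simp: f_def g_def)
    ultimately show False using h h0 by simp
  qed
  then obtain s t where "f s = g t" by auto
  then have "p dvd s\<^sup>2 - (c - d * t\<^sup>2)" by (simp add: f_def g_def mod_eq_dvd_iff)
  then show ?thesis by (intro exI[of _ s] exI[of _ t]) (simp add: cong_iff_dvd_diff algebra_simps)
qed

section \<open>Levels of the Eisenstein norm form modulo \<open>p\<close>\<close>

definition eisenstein_form :: "int \<Rightarrow> int \<Rightarrow> int" where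
  "eisenstein_form x y = x * x + x * y + y * y"

lemma residue_periodic_eisenstein_form: "residue_periodic p eisenstein_form"
  by (auto simp: residue_periodic_def eisenstein_form_def intro!: cong_add cong_mult)

text \<open>Multiplicativity of the norm \<open>eisenstein_form x y\<close> of the Eisenstein integer \<open>x - y \<omega>\<close>.\<close>
lemma eisenstein_form_mult:
  "eisenstein_form (z * x + (- w) * y) (w * x + (z + w) * y) =
     eisenstein_form x y * eisenstein_form z w"
  by (simp add: eisenstein_form_def algebra_simps)

lemma not_dvd_2_3:
  fixes p :: int
  assumes "p > 3"
  shows "\<not> p dvd 2" "\<not> p dvd 3"
  using assms by (auto dest: zdvd_imp_le)

text \<open>Completing the square, 4 Q(x, y) = (2x + y)^2 + 3 y^2. So s^2 + 3 t^2 = 4c is solved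
  first, and then y = t and x = (s - t)/2 modulo \<open>p\<close>.\<close>

lemma eisenstein_form_represents_mod_prime:
  fixes p c :: int
  assumes p: "prime p" "p > 3"
  shows "\<exists>x y. [eisenstein_form x y = c] (mod p)"
proof -
  note nd = not_dvd_2_3[OF p(2)]
  obtain s t where "[s\<^sup>2 + 3 * t\<^sup>2 = 4 * c] (mod p)"
    using sum_of_squares_represents_mod_prime[OF p(1) _ nd(2)] p by force
  then have st: "p dvd s\<^sup>2 + 3 * t\<^sup>2 - 4 * c" by (simp add: cong_iff_dvd_diff)
  obtain b where "[2 * b = 1] (mod p)" using mod_prime_inverse_exists[OF p(1) nd(1)] .
  then have b: "p dvd 2 * b - 1" by (simp add: cong_iff_dvd_diff)
  define x where "x = b * (s - t)"
  \<comment> \<open>Here 2x + t - s = (2b - 1)(s - t), so the last summand is the difference of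
    squares (2x + t)^2 - s^2.\<close>
  have "4 * (eisenstein_form x t - c) =
      (s\<^sup>2 + 3 * t\<^sup>2 - 4 * c) + (2 * b - 1) * ((s - t) * (2 * x + t + s))"
    by (simp add: x_def eisenstein_form_def power2_eq_square algebra_simps)
  then have "p dvd 4 * (eisenstein_form x t - c)"
    by (simp only: dvd_add[OF st dvd_mult2[OF b]])
  also have "4 * (eisenstein_form x t - c) = 2 * (2 * (eisenstein_form x t - c))" by simp
  finally have "p dvd 2 * (2 * (eisenstein_form x t - c))" .
  then have "p dvd eisenstein_form x t - c"
    using p(1) nd(1) by (metis prime_dvd_mult_iff)
  then show ?thesis by (auto simp: cong_iff_dvd_diff)
qed

text \<open>The multiplier has norm l/k modulo \<open>p\<close>. The determinant of multiplication
  by an Eisenstein integer is its norm, here a unit, whence injectivity. The hypotheses are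
  symmetric in \<open>k\<close> and \<open>l\<close>, so exchanging them gives equality.\<close>

lemma card_eisenstein_form_level_le:
  fixes p k l :: int
  assumes p: "prime p" "p > 3" and k: "\<not> p dvd k" and l: "\<not> p dvd l"
  shows "card (residue_solutions p eisenstein_form k) \<le> card (residue_solutions p eisenstein_form l)"
proof -
  obtain b where b: "[k * b = 1] (mod p)" using mod_prime_inverse_exists[OF p(1) k] .
  obtain z w where zw: "[eisenstein_form z w = b * l] (mod p)"
    using eisenstein_form_represents_mod_prime[OF p] by blast
  have "\<not> p dvd b"
  proof
    assume "p dvd b"
    then have "p dvd 1" using b by (metis cong_dvd_iff dvd_mult)
    then show False using p by (auto dest: zdvd_imp_le)
  qed
  then have "\<not> p dvd eisenstein_form z w"
    using zw l p(1) by (simp add: cong_dvd_iff prime_dvd_mult_iff)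
  moreover have "z * (z + w) - (- w) * w = eisenstein_form z w"
    by (simp add: eisenstein_form_def algebra_simps)
  ultimately have det: "\<not> p dvd z * (z + w) - (- w) * w" by simp
  show ?thesis
  proof (rule card_residue_solutions_le[where F = "\<lambda>x y. z * x + (- w) * y"
        and G = "\<lambda>x y. w * x + (z + w) * y"])
    show "p > 0" using p by simp
  next
    fix x y assume "[eisenstein_form x y = k] (mod p)"
    then have "[eisenstein_form x y * eisenstein_form z w = k * (b * l)] (mod p)"
      using zw by (rule cong_mult)
    also have "[k * (b * l) = 1 * l] (mod p)"
      using cong_mult[OF b cong_refl[of l]] by (simp add: mult.assoc)
    finally show "[eisenstein_form (z * x + (- w) * y) (w * x + (z + w) * y) = l] (mod p)"
      by (simp only: eisenstein_form_mult mult_1)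
  qed (use p residue_periodic_eisenstein_form linear_map_inj_mod_prime[OF p(1) det] in blast)+
qed

lemma card_eisenstein_form_levels:
  fixes p k :: int
  assumes p: "prime p" "p > 3" and k: "\<not> p dvd k"
  shows "card (residue_solutions p eisenstein_form 0)
           + (nat p - 1) * card (residue_solutions p eisenstein_form k) = nat p * nat p"
proof -
  let ?c = "\<lambda>u. card (residue_solutions p eisenstein_form u)"
  have "?c u = ?c k" if "u \<in> {1..<p}" for u
  proof -
    have "\<not> p dvd u" using that by (auto dest: zdvd_imp_le)
    then show ?thesis using card_eisenstein_form_level_le[OF p] k by (meson antisym)
  qed
  moreover have "nat (p - 1) = nat p - 1" using p by simp
  ultimately have "(\<Sum>u\<in>{1..<p}. ?c u) = (nat p - 1) * ?c k" by simp
  moreover have "{0..<p} = insert 0 {1..<p}" using p by auto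
  ultimately show ?thesis
    using sum_card_residue_solutions[of p eisenstein_form] p by simp
qed

text \<open>Off the origin, a zero of the form gives \<open>x ^ 3 = y ^ 3\<close> with \<open>x \<noteq> y\<close>, but
  cubing is injective when \<open>p - 1\<close> is coprime to 3.\<close>
lemma card_eisenstein_form_zeros_inert:
  fixes p :: nat
  assumes p: "prime p" "p > 3" and mod3: "p mod 3 = 2"
  shows "card (residue_solutions (int p) eisenstein_form 0) = 1"
proof -
  have pp: "prime (int p)" using p by simp
  have nd: "\<not> int p dvd 3" using not_dvd_2_3[of "int p"] p by simp
  have zero: "int p dvd y" if Q: "int p dvd eisenstein_form x y" for x y
  proof (rule ccontr)
    assume y: "\<not> int p dvd y"
    have x: "\<not> int p dvd x"
    proof
      assume "int p dvd x"
      moreover have "y * y = eisenstein_form x y - x * (x + y)"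
        by (simp add: eisenstein_form_def algebra_simps)
      ultimately have "int p dvd y * y" using Q by simp
      with y pp show False by (simp add: prime_dvd_mult_iff)
    qed
    have "x ^ 3 - y ^ 3 = eisenstein_form x y * (x - y)"
      by (simp add: eisenstein_form_def power3_eq_cube algebra_simps)
    then have cubes: "[x ^ 3 = y ^ 3] (mod int p)" using Q by (simp add: cong_iff_dvd_diff)
    \<comment> \<open>With p = 3k + 2, Fermat gives x^(3k+1) = 1 = y^(3k+1), while equal cubes give
      x^(3k) = y^(3k); cancelling leaves x = y modulo \<open>p\<close>.\<close>
    define k where "k = p div 3"
    have k: "p - 1 = 3 * k + 1" using mod3 p unfolding k_def by presburger
    have "[x ^ (3 * k + 1) = y ^ (3 * k + 1)] (mod int p)"
      using fermat_theorem_int[OF p(1) x] fermat_theorem_int[OF p(1) y] k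
      by (metis cong_sym cong_trans)
    then have "[x ^ (3 * k) * x = y ^ (3 * k) * y] (mod int p)" by (simp add: mult.commute)
    moreover have "[x ^ (3 * k) = y ^ (3 * k)] (mod int p)"
      using cong_pow[OF cubes, of k] by (simp add: power_mult)
    ultimately have "[x ^ (3 * k) * x = x ^ (3 * k) * y] (mod int p)"
      by (metis cong_scalar_right cong_sym cong_trans)
    then have "int p dvd x ^ (3 * k) * (x - y)"
      by (simp add: cong_iff_dvd_diff algebra_simps)
    then have "int p dvd x - y"
      using pp x by (metis prime_dvd_mult_iff prime_dvd_power)
    \<comment> \<open>On the diagonal the form is 3 y^2, which is nonzero modulo
      \<open>p\<close>.\<close>
    moreover have "3 * (y * y) = eisenstein_form x y - (x - y) * (x + 2 * y)"
      by (simp add: eisenstein_form_def algebra_simps)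
    ultimately have "int p dvd 3 * (y * y)" using Q by simp
    with y nd pp show False by (simp add: prime_dvd_mult_iff)
  qed
  have "residue_solutions (int p) eisenstein_form 0 = {(0, 0)}"
  proof
    show "{(0, 0)} \<subseteq> residue_solutions (int p) eisenstein_form 0"
      using p by (simp add: residue_solutions_def eisenstein_form_def)
    show "residue_solutions (int p) eisenstein_form 0 \<subseteq> {(0, 0)}"
    proof clarify
      fix x y assume "(x, y) \<in> residue_solutions (int p) eisenstein_form 0"
      then have xy: "0 \<le> x" "x < int p" "0 \<le> y" "y < int p" and Q: "int p dvd eisenstein_form x y"
        by (auto simp: residue_solutions_def cong_0_iff)
      \<comment> \<open>The claim \<open>zero\<close> speaks of the second coordinate only; symmetry
        gives the first.\<close>
      have "eisenstein_form y x = eisenstein_form x y"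
        by (simp add: eisenstein_form_def algebra_simps)
      then have "int p dvd x" "int p dvd y" using zero[of x y] zero[of y x] Q by auto
      then show "x = 0 \<and> y = 0" using xy by (auto dest: zdvd_imp_le)
    qed
  qed
  then show ?thesis by simp
qed

text \<open>For a primitive root \<open>g\<close>, the power w = g^((p-1)/3) satisfies w^3 = 1 but
  not w = 1, so \<open>p\<close> divides the other factor of w^3 - 1.\<close>

lemma cube_root_of_unity_mod_prime:
  fixes p :: nat
  assumes p: "prime p" and mod3: "p mod 3 = 1"
  shows "\<exists>w::int. int p dvd w * w + w + 1"
proof -
  have p1: "p > 1" using p prime_gt_1_nat by blast
  obtain g where g: "ord p g = p - 1"
    using residue_prime_has_primroot[OF p] by blast
  define k where "k = p div 3"
  have k: "p - 1 = 3 * k" "k > 0" using mod3 p1 unfolding k_def by presburger+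
  define w where "w = int (g ^ k)"
  have "\<not> [g ^ k = 1] (mod p)" using ord_minimal[of k p g] g k by simp
  then have "\<not> [w = 1] (mod int p)"
    unfolding w_def by (metis cong_int_iff of_nat_1)
  then have 1: "\<not> int p dvd w - 1" by (simp add: cong_iff_dvd_diff)
  have "[g ^ (3 * k) = 1] (mod p)" using ord[of g p] g k by simp
  then have "[w ^ 3 = 1] (mod int p)"
    unfolding w_def by (metis cong_int_iff of_nat_1 of_nat_power power_mult mult.commute)
  then have "int p dvd w ^ 3 - 1" by (simp add: cong_iff_dvd_diff)
  also have "w ^ 3 - 1 = (w - 1) * (w * w + w + 1)"
    by (simp add: power3_eq_cube algebra_simps)
  finally show ?thesis using 1 p by (auto simp: prime_dvd_mult_iff)
qed

text \<open>Two axes sharing the origin: the model with which the zero level is compared when the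
  norm form splits.\<close>

lemma card_product_zeros:
  fixes p :: int
  assumes "prime p"
  shows "card (residue_solutions p (*) 0) = 2 * nat p - 1"
proof -
  have p: "p > 0" using assms prime_gt_0_int by simp
  have dvd: "p dvd x \<longleftrightarrow> x = 0" if "0 \<le> x" "x < p" for x
    using that by (auto dest: zdvd_imp_le)
  have eq: "residue_solutions p (*) 0 = {0} \<times> {0..<p} \<union> {1..<p} \<times> {0}"
    using assms p by (auto simp: residue_solutions_def cong_0_iff prime_dvd_mult_iff dvd)
  have "card (residue_solutions p (*) 0) = nat p + nat (p - 1)"
    unfolding eq by (subst card_Un_disjoint) (auto simp: card_cartesian_product)
  then show ?thesis using p by simp
qed

text \<open>With a cube root of unity \<open>w\<close> the form factors as \<open>(x - w y) (x - w\<^sup>2 y)\<close>.\<close>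
lemma card_eisenstein_form_zeros_split:
  fixes p :: nat
  assumes p: "prime p" "p > 3" and mod3: "p mod 3 = 1"
  shows "card (residue_solutions (int p) eisenstein_form 0) = 2 * p - 1"
proof -
  have pp: "prime (int p)" using p by simp
  have nd: "\<not> int p dvd 3" using not_dvd_2_3[of "int p"] p by simp
  obtain w where w: "int p dvd w * w + w + 1"
    using cube_root_of_unity_mod_prime[OF p(1) mod3] by blast
  \<comment> \<open>The difference of the two roots, which is also the determinant of both
    substitutions below. Its square is -3 modulo \<open>p\<close>.\<close>
  have disc: "\<not> int p dvd w - w * w"
  proof
    assume "int p dvd w - w * w"
    moreover have "3 = (w * w + w + 1) * (w * w - 3 * w + 3) - (w - w * w) * (w - w * w)"
      by (simp add: algebra_simps)
    ultimately have "int p dvd 3" using w by (metis dvd_diff dvd_mult2)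
    with nd show False ..
  qed
  have fac: "eisenstein_form x y = (x - w * y) * (x - w * w * y) + (w * w + w + 1) * (x * y + y * y - w * y * y)"
    for x y
    by (simp add: eisenstein_form_def algebra_simps)
  have "card (residue_solutions (int p) eisenstein_form 0) \<le> card (residue_solutions (int p) (*) 0)"
  proof (rule card_residue_solutions_le[where F = "\<lambda>x y. 1 * x + (- w) * y"
        and G = "\<lambda>x y. 1 * x + (- (w * w)) * y"])
    show "int p > 0" using p by simp
    show "residue_periodic (int p) (*)" by (auto simp: residue_periodic_def intro: cong_mult)
  next
    fix x y assume "[eisenstein_form x y = 0] (mod int p)"
    then have "int p dvd eisenstein_form x y - (w * w + w + 1) * (x * y + y * y - w * y * y)"
      using w by (simp add: cong_0_iff)
    then show "[(1 * x + (- w) * y) * (1 * x + (- (w * w)) * y) = 0] (mod int p)"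
      by (simp add: cong_0_iff fac)
  next
    have "\<not> int p dvd 1 * (- (w * w)) - (- w) * 1" using disc by simp
    from linear_map_inj_mod_prime[OF pp this]
    show "[x = x'] (mod int p) \<and> [y = y'] (mod int p)"
      if "[1 * x + (- w) * y = 1 * x' + (- w) * y'] (mod int p)"
        "[1 * x + (- (w * w)) * y = 1 * x' + (- (w * w)) * y'] (mod int p)" for x y x' y'
      using that by blast
  qed
  moreover have "card (residue_solutions (int p) (*) 0) \<le> card (residue_solutions (int p) eisenstein_form 0)"
  \<comment> \<open>Solving s = x - w y, t = x - w^2 y for \<open>x\<close> and \<open>y\<close> and
    clearing the denominator w^2 - w gives these coefficients. The form then becomes s t times the
    square of that denominator, modulo \<open>p\<close>.\<close>
  proof (rule card_residue_solutions_le[where F = "\<lambda>s t. (w * w) * s + (- w) * t"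
        and G = "\<lambda>s t. 1 * s + (- 1) * t"])
    show "int p > 0" using p by simp
    show "residue_periodic (int p) eisenstein_form" by (rule residue_periodic_eisenstein_form)
  next
    fix s t assume st: "[s * t = 0] (mod int p)"
    let ?F = "(w * w) * s + (- w) * t" and ?G = "1 * s + (- 1) * t"
    have "eisenstein_form ?F ?G = (s * t) * ((w - w * w) * (w - w * w)) +
        (w * w + w + 1) * (?F * ?G + ?G * ?G - w * ?G * ?G)"
      unfolding fac by (simp add: algebra_simps)
    moreover have "int p dvd s * t" using st by (simp add: cong_0_iff)
    ultimately show "[eisenstein_form ?F ?G = 0] (mod int p)"
      using w by (metis cong_0_iff dvd_add dvd_mult2)
  next
    have "\<not> int p dvd (w * w) * (- 1) - (- w) * 1" using disc by simp
    from linear_map_inj_mod_prime[OF pp this]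
    show "[x = x'] (mod int p) \<and> [y = y'] (mod int p)"
      if "[(w * w) * x + (- w) * y = (w * w) * x' + (- w) * y'] (mod int p)"
        "[1 * x + (- 1) * y = 1 * x' + (- 1) * y'] (mod int p)" for x y x' y'
      using that by blast
  qed
  ultimately show ?thesis using card_product_zeros[OF pp] by simp
qed

section \<open>The two networks and their reduction to levels of the norm form\<close>

lemma network_eqI: "is_network a b c W \<Longrightarrow> network a b c = W"
  using is_network_unique is_network_network by blast

lemma network_0_1_1: "network 0 1 1 = eisenstein_form"
  by (rule network_eqI) (simp add: is_network_def lozenge_rule_def eisenstein_form_def algebra_simps)

lemma network_0_0_0: "network 0 0 0 = (\<lambda>x y. eisenstein_form x y - x - y)"
  by (rule network_eqI) (simp add: is_network_def lozenge_rule_def eisenstein_form_def algebra_simps)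

lemma residue_periodic_shifted_form: "residue_periodic p (\<lambda>x y. eisenstein_form x y - x - y)"
  using residue_periodic_eisenstein_form[of p]
  unfolding residue_periodic_def by (blast intro: cong_diff)

text \<open>Modulo \<open>p\<close>, centring at \<open>(t, t)\<close> with \<open>3 t = 1\<close> removes the linear terms.\<close>
lemma card_shifted_form_level:
  fixes p u v :: int
  assumes p: "prime p" "p > 3" and uv: "[3 * v = 3 * u + 1] (mod p)"
  shows "card (residue_solutions p (\<lambda>x y. eisenstein_form x y - x - y) u) =
         card (residue_solutions p eisenstein_form v)"
proof -
  note nd = not_dvd_2_3[OF p(2)]
  obtain t where "[3 * t = 1] (mod p)" using mod_prime_inverse_exists[OF p(1) nd(2)] .
  then have t: "p dvd 3 * t - 1" by (simp add: cong_iff_dvd_diff)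
  have "p dvd (3 * v - (3 * u + 1)) - (3 * t - 1)"
    by (rule dvd_diff) (use uv t in \<open>simp_all only: cong_iff_dvd_diff\<close>)
  also have "\<dots> = 3 * (v - u - t)" by simp
  finally have vut: "p dvd v - u - t" using p(1) nd by (metis prime_dvd_mult_iff)
  \<comment> \<open>Expanding, Q(x - t, y - t) = Q - 3t(x + y) + 3t^2, which is Q - x - y + t once
    3t = 1. The constant \<open>t\<close> is the shift from \<open>u\<close> to
    \<open>v\<close>.\<close>
  have centre: "eisenstein_form (x - t) (y - t) - v =
      (eisenstein_form x y - x - y - u) - ((3 * t - 1) * (x + y - t) + (v - u - t))" for x y
    by (simp add: eisenstein_form_def algebra_simps)
  have iff: "[eisenstein_form (x - t) (y - t) = v] (mod p) \<longleftrightarrow>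
      [eisenstein_form x y - x - y = u] (mod p)" for x y
  proof -
    have "p dvd (3 * t - 1) * (x + y - t) + (v - u - t)"
      using dvd_add[OF dvd_mult2[OF t] vut] .
    from dvd_add_left_iff[OF this, of "eisenstein_form (x - t) (y - t) - v"]
    show ?thesis unfolding cong_iff_dvd_diff by (simp only: centre diff_add_cancel)
  qed
  have p0: "p > 0" using p by simp
  have inj: "[x + s = x' + s] (mod p) \<Longrightarrow> [y + s = y' + s] (mod p) \<Longrightarrow>
      [x = x'] (mod p) \<and> [y = y'] (mod p)" for x y x' y' s
    by (simp add: cong_iff_dvd_diff)
  show ?thesis
  proof (rule antisym)
    show "card (residue_solutions p (\<lambda>x y. eisenstein_form x y - x - y) u) \<le>
        card (residue_solutions p eisenstein_form v)"
      by (rule card_residue_solutions_le[where F = "\<lambda>x y. x + - t" and G = "\<lambda>x y. y + - t",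
            OF p0 residue_periodic_eisenstein_form _ inj[of _ "- t"]]) (simp_all add: iff)
    show "card (residue_solutions p eisenstein_form v) \<le>
        card (residue_solutions p (\<lambda>x y. eisenstein_form x y - x - y) u)"
    proof (rule card_residue_solutions_le[where F = "\<lambda>x y. x + t" and G = "\<lambda>x y. y + t",
            OF p0 residue_periodic_shifted_form _ inj[of _ t]])
      fix x y assume "[eisenstein_form x y = v] (mod p)"
      then show "[eisenstein_form (x + t) (y + t) - (x + t) - (y + t) = u] (mod p)"
        using iff[of "x + t" "y + t"] by simp
    qed
  qed
qed

lemma network_density_residue_solutions:
  fixes p u :: nat
  assumes "p > 0"
  shows "has_residue_density (network 0 0 0) p u
      (real (card (residue_solutions (int p) (\<lambda>x y. eisenstein_form x y - x - y) (int u))) / (real p)\<^sup>2)"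
    and "has_residue_density (network 0 1 1) p u
      (real (card (residue_solutions (int p) eisenstein_form (int u))) / (real p)\<^sup>2)"
  unfolding network_0_0_0 network_0_1_1
  by (intro has_residue_density_periodic assms residue_periodic_shifted_form
      residue_periodic_eisenstein_form)+

lemma network_0_0_0_density_eq:
  fixes p u :: nat
  assumes p: "prime p" "p > 3" and v: "[3 * v = 3 * int u + 1] (mod int p)"
  shows "has_residue_density (network 0 0 0) p u
      (real (card (residue_solutions (int p) eisenstein_form v)) / (real p)\<^sup>2)"
proof -
  have "p > 0" using p by simp
  from network_density_residue_solutions(1)[OF this, of u]
  show ?thesis
    using card_shifted_form_level[of "int p", OF _ _ v] p by simp
qed

lemma card_eisenstein_form_nonzero_level:
  fixes p :: nat and v :: int
  assumes p: "prime p" "p > 3" and v: "\<not> int p dvd v"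
  shows "p mod 3 = 1 \<Longrightarrow> card (residue_solutions (int p) eisenstein_form v) = p - 1"
    and "p mod 3 = 2 \<Longrightarrow> card (residue_solutions (int p) eisenstein_form v) = p + 1"
proof -
  let ?c = "\<lambda>u. card (residue_solutions (int p) eisenstein_form u)"
  have sum: "?c 0 + (p - 1) * ?c v = p * p"
    using card_eisenstein_form_levels[of "int p" v] p v by simp
  \<comment> \<open>Without truncated subtraction, p^2 - (2p - 1) = q^2 and p^2 - 1 = q(q + 2); the
    factor q = p - 1, the number of nonzero levels, then cancels.\<close>
  obtain q where q: "p = q + 1" "q > 0"
    using p by (intro that[of "p - 1"]) auto
  show "?c v = p - 1" if "p mod 3 = 1"
  proof -
    have "q * ?c v = q * q"
      using sum card_eisenstein_form_zeros_split[OF p that] q by simp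
    then show ?thesis using q by simp
  qed
  show "?c v = p + 1" if "p mod 3 = 2"
  proof -
    have "q * ?c v = q * (q + 2)"
      using sum card_eisenstein_form_zeros_inert[OF p that] q by simp
    then have "?c v = q + 2" using q by (simp only: mult_cancel1) simp
    then show ?thesis using q by simp
  qed
qed

section \<open>Densities for \<open>p = 2\<close>, for \<open>p = 3\<close> and for
  \<open>p > 3\<close>\<close>

lemma residues_2_3: "{0..<2::int} = {0, 1}" "{0..<3::int} = {0, 1, 2}"
  by auto

text \<open>The general argument halves when completing the square and divides by 3 when centring,
  so the primes 2 and 3 are settled by enumeration.\<close>

lemma network_densities_mod_2:
  "has_residue_density (network 0 0 0) 2 0 (3 / 4)"
  "has_residue_density (network 0 0 0) 2 1 (1 / 4)"
  "has_residue_density (network 0 1 1) 2 0 (1 / 4)"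
  "has_residue_density (network 0 1 1) 2 1 (3 / 4)"
  using network_density_residue_solutions[of 2 0] network_density_residue_solutions[of 2 1]
  by (simp_all add: card_residue_solutions_eq_sum residues_2_3 eisenstein_form_def cong_def)

lemma network_densities_mod_3:
  "has_residue_density (network 0 0 0) 3 0 (3 / 9)"
  "has_residue_density (network 0 0 0) 3 1 (3 / 9)"
  "has_residue_density (network 0 0 0) 3 2 (3 / 9)"
  "has_residue_density (network 0 1 1) 3 0 (3 / 9)"
  "has_residue_density (network 0 1 1) 3 1 (6 / 9)"
  "has_residue_density (network 0 1 1) 3 2 0"
  using network_density_residue_solutions[of 3 0] network_density_residue_solutions[of 3 1]
    network_density_residue_solutions[of 3 2]
  by (simp_all add: card_residue_solutions_eq_sum residues_2_3 eisenstein_form_def cong_def)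

text \<open>Level \<open>u\<close> of this network corresponds to level u + 1/3 of the norm form, so
  the exceptional residue is -1/3, which is what \<open>p dvd 3 * u + 1\<close> expresses.\<close>

lemma network_0_0_0_density:
  fixes p u :: nat
  assumes p: "prime p" "p > 3"
  shows "p mod 3 = 1 \<Longrightarrow> p dvd 3 * u + 1 \<Longrightarrow>
      has_residue_density (network 0 0 0) p u ((2 * real p - 1) / (real p)\<^sup>2)"
    and "p mod 3 = 1 \<Longrightarrow> \<not> p dvd 3 * u + 1 \<Longrightarrow>
      has_residue_density (network 0 0 0) p u ((real p - 1) / (real p)\<^sup>2)"
    and "p mod 3 = 2 \<Longrightarrow> p dvd 3 * u + 1 \<Longrightarrow>
      has_residue_density (network 0 0 0) p u (1 / (real p)\<^sup>2)"
    and "p mod 3 = 2 \<Longrightarrow> \<not> p dvd 3 * u + 1 \<Longrightarrow>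
      has_residue_density (network 0 0 0) p u ((real p + 1) / (real p)\<^sup>2)"
proof -
  have pp: "prime (int p)" using p by simp
  have nd: "\<not> int p dvd 3" using not_dvd_2_3[of "int p"] p by simp
  obtain t where t: "[3 * t = 1] (mod int p)" using mod_prime_inverse_exists[OF pp nd] .
  define v where "v = t * (3 * int u + 1)"
  have v: "[3 * v = 3 * int u + 1] (mod int p)"
    using cong_mult[OF t cong_refl[of "3 * int u + 1"]] by (simp add: v_def mult.assoc)
  then have "int p dvd 3 * v \<longleftrightarrow> int p dvd 3 * int u + 1" by (rule cong_dvd_iff)
  also have "int p dvd 3 * int u + 1 \<longleftrightarrow> p dvd 3 * u + 1"
    using int_dvd_int_iff[of p "3 * u + 1"] by (simp add: add.commute)
  finally have dvd: "int p dvd v \<longleftrightarrow> p dvd 3 * u + 1"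
    using pp nd by (simp add: prime_dvd_mult_iff)
  let ?c = "card (residue_solutions (int p) eisenstein_form v)"
  have c0: "?c = card (residue_solutions (int p) eisenstein_form 0)" if "p dvd 3 * u + 1"
    using that dvd by (simp add: residue_solutions_cong[of v 0] cong_0_iff)
  note dens = network_0_0_0_density_eq[OF p v]
  note zeros = card_eisenstein_form_zeros_split[OF p] card_eisenstein_form_zeros_inert[OF p]
  note nonzero = card_eisenstein_form_nonzero_level[OF p, of v]
  show "has_residue_density (network 0 0 0) p u ((2 * real p - 1) / (real p)\<^sup>2)"
    if "p mod 3 = 1" "p dvd 3 * u + 1"
    using dens c0 zeros(1) that p by (simp add: of_nat_diff)
  show "has_residue_density (network 0 0 0) p u ((real p - 1) / (real p)\<^sup>2)"
    if "p mod 3 = 1" "\<not> p dvd 3 * u + 1"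
    using dens nonzero(1) dvd that p by (simp add: of_nat_diff)
  show "has_residue_density (network 0 0 0) p u (1 / (real p)\<^sup>2)"
    if "p mod 3 = 2" "p dvd 3 * u + 1"
    using dens c0 zeros(2) that by simp
  show "has_residue_density (network 0 0 0) p u ((real p + 1) / (real p)\<^sup>2)"
    if "p mod 3 = 2" "\<not> p dvd 3 * u + 1"
    using dens nonzero(2) dvd that by (simp add: add.commute)
qed

lemma network_0_1_1_density:
  fixes p u :: nat
  assumes p: "prime p" "p > 3"
  shows "p mod 3 = 1 \<Longrightarrow> has_residue_density (network 0 1 1) p 0 ((2 * real p - 1) / (real p)\<^sup>2)"
    and "p mod 3 = 1 \<Longrightarrow> \<not> p dvd u \<Longrightarrow>
      has_residue_density (network 0 1 1) p u ((real p - 1) / (real p)\<^sup>2)"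
    and "p mod 3 = 2 \<Longrightarrow> has_residue_density (network 0 1 1) p 0 (1 / (real p)\<^sup>2)"
    and "p mod 3 = 2 \<Longrightarrow> \<not> p dvd u \<Longrightarrow>
      has_residue_density (network 0 1 1) p u ((real p + 1) / (real p)\<^sup>2)"
proof -
  have "p > 0" using p by simp
  note dens = network_density_residue_solutions(2)[OF this]
  note zeros = card_eisenstein_form_zeros_split[OF p] card_eisenstein_form_zeros_inert[OF p]
  note nonzero = card_eisenstein_form_nonzero_level[OF p, of "int u"]
  show "has_residue_density (network 0 1 1) p 0 ((2 * real p - 1) / (real p)\<^sup>2)" if "p mod 3 = 1"
    using dens[of 0] zeros(1) that p by (simp add: of_nat_diff)
  show "has_residue_density (network 0 1 1) p u ((real p - 1) / (real p)\<^sup>2)"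
    if "p mod 3 = 1" "\<not> p dvd u"
    using dens[of u] nonzero(1) that p by (simp add: of_nat_diff)
  show "has_residue_density (network 0 1 1) p 0 (1 / (real p)\<^sup>2)" if "p mod 3 = 2"
    using dens[of 0] zeros(2) that by simp
  show "has_residue_density (network 0 1 1) p u ((real p + 1) / (real p)\<^sup>2)"
    if "p mod 3 = 2" "\<not> p dvd u"
    using dens[of u] nonzero(2) that by (simp add: add.commute)
qed

text \<open>As 3u + 1 is positive and below 3p, it can only be p or 2p; being 1 modulo 3, it is p
  when p is 1 modulo 3 and 2p when p is 2 modulo 3. Both divisions by 3 are exact.\<close>

lemma dvd_three_mult_add_one_iff:
  fixes p u :: nat
  assumes "p > 3" "u \<le> p - 1"
  shows "p mod 3 = 1 \<Longrightarrow> p dvd 3 * u + 1 \<longleftrightarrow> u = (p - 1) div 3"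
    and "p mod 3 = 2 \<Longrightarrow> p dvd 3 * u + 1 \<longleftrightarrow> u = (2 * p - 1) div 3"
proof -
  have small: "3 * u + 1 = p \<or> 3 * u + 1 = 2 * p" if "p dvd 3 * u + 1"
  proof -
    obtain k where k: "3 * u + 1 = p * k" using \<open>p dvd 3 * u + 1\<close> by (elim dvdE)
    have "p * k < p * 3" using k assms by linarith
    then have "k < 3" by simp
    then have "k = 0 \<or> k = 1 \<or> k = 2" by auto
    then show ?thesis using k by auto
  qed
  show "p dvd 3 * u + 1 \<longleftrightarrow> u = (p - 1) div 3" if p3: "p mod 3 = 1"
  proof -
    obtain k where p: "p = 3 * k + 1" using p3 mult_div_mod_eq[of 3 p] by metis
    have "u = k" if "p dvd 3 * u + 1"
      using small[OF that] unfolding p by presburger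
    moreover have "(p - 1) div 3 = k" unfolding p by simp
    ultimately show ?thesis using p by auto
  qed
  show "p dvd 3 * u + 1 \<longleftrightarrow> u = (2 * p - 1) div 3" if p3: "p mod 3 = 2"
  proof -
    obtain k where p: "p = 3 * k + 2" using p3 mult_div_mod_eq[of 3 p] by metis
    have "u = 2 * k + 1" if "p dvd 3 * u + 1"
      using small[OF that] unfolding p by presburger
    moreover have "(2 * p - 1) div 3 = 2 * k + 1" unfolding p by simp
    moreover have "p dvd 3 * (2 * k + 1) + 1" unfolding p by (rule dvdI[of _ _ 2]) simp
    ultimately show ?thesis by metis
  qed
qed

theorem theorem1p3:
  fixes p :: nat
  assumes "prime p"
  shows
    "(p = 2 \<longrightarrow>
        has_residue_density (network 0 0 0) p 0 (3 / 4) \<and>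
        has_residue_density (network 0 0 0) p 1 (1 / 4)) \<and>
     (p = 3 \<longrightarrow>
        has_residue_density (network 0 0 0) p 0 (3 / 9) \<and>
        has_residue_density (network 0 0 0) p 1 (3 / 9) \<and>
        has_residue_density (network 0 0 0) p 2 (3 / 9)) \<and>
     (p \<ge> 5 \<and> [p = 1] (mod 6) \<longrightarrow>
        has_residue_density (network 0 0 0) p ((p - 1) div 3) ((2 * real p - 1) / (real p)\<^sup>2) \<and>
        (\<forall>u\<in>{0..p - 1}. u \<noteq> (p - 1) div 3 \<longrightarrow>
           has_residue_density (network 0 0 0) p u ((real p - 1) / (real p)\<^sup>2))) \<and>
     (p \<ge> 5 \<and> [p = 5] (mod 6) \<longrightarrow>
        has_residue_density (network 0 0 0) p ((2 * p - 1) div 3) (1 / (real p)\<^sup>2) \<and>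
        (\<forall>u\<in>{0..p - 1}. u \<noteq> (2 * p - 1) div 3 \<longrightarrow>
           has_residue_density (network 0 0 0) p u ((real p + 1) / (real p)\<^sup>2))) \<and>
     (p = 2 \<longrightarrow>
        has_residue_density (network 0 1 1) p 0 (1 / 4) \<and>
        has_residue_density (network 0 1 1) p 1 (3 / 4)) \<and>
     (p = 3 \<longrightarrow>
        has_residue_density (network 0 1 1) p 0 (3 / 9) \<and>
        has_residue_density (network 0 1 1) p 1 (6 / 9) \<and>
        has_residue_density (network 0 1 1) p 2 0) \<and>
     (p \<ge> 5 \<and> [p = 1] (mod 6) \<longrightarrow>
        has_residue_density (network 0 1 1) p 0 ((2 * real p - 1) / (real p)\<^sup>2) \<and>
        (\<forall>u\<in>{1..p - 1}.
           has_residue_density (network 0 1 1) p u ((real p - 1) / (real p)\<^sup>2))) \<and>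
     (p \<ge> 5 \<and> [p = 5] (mod 6) \<longrightarrow>
        has_residue_density (network 0 1 1) p 0 (1 / (real p)\<^sup>2) \<and>
        (\<forall>u\<in>{1..p - 1}.
           has_residue_density (network 0 1 1) p u ((real p + 1) / (real p)\<^sup>2)))"
proof -
  have mod3: "p mod 3 = 1" if "[p = 1] (mod 6)" using that unfolding cong_def by presburger
  have mod3': "p mod 3 = 2" if "[p = 5] (mod 6)" using that unfolding cong_def by presburger
  \<comment> \<open>The exceptional residues lie in the range where the divisibility criterion
    identifies them.\<close>
  have le: "(p - 1) div 3 \<le> p - 1" "(2 * p - 1) div 3 \<le> p - 1" if "p \<ge> 5"
    using that by presburger+
  have nd: "\<not> p dvd u" if "u \<in> {1..p - 1}" for u
    using that by (auto dest: dvd_imp_le)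
  show ?thesis
    using network_densities_mod_2 network_densities_mod_3
      network_0_0_0_density[OF assms] network_0_1_1_density[OF assms]
      dvd_three_mult_add_one_iff[of p] mod3 mod3' le nd
    by (intro conjI impI ballI) auto
qed

end
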